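(* Let $\Omega\subset\mathbb R^n$ be an open set equipped with the Euclidean distance $\mathsf d_e$, let $w\in C^1(\Omega)$ and let $\mu$ be the measure on $\Omega$ with density $w$ with respect to the Lebesgue measure, where $(\Omega,\mathsf d_e,\mu)$ is a metric measure space. Then for any $x\in\Omega$ such that $w(x)>0$, any $u\in C^2(\Omega)$ admits a pointwise AMV Laplacian and a pointwise SAMV Laplacian at $x$, and $$\Delta^{\mathsf d_e}_\mu u(x)=\frac1{2(n+2)}\big(\Delta u(x)+2\langle\nabla\ln w,\nabla u\rangle(x)\big),$$ $$\tilde\Delta^{\mathsf d_e}_\mu u(x)=\frac1{2(n+2)}\big(\Delta u(x)+\langle\nabla\ln w,\nabla u\rangle(x)\big),$$ where $\Delta=\sum_i\partial_{ii}$ is the classical Laplacian.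
   Context: A metric measure space $(X,\mathsf d,\mu)$ is a metric space $(X,\mathsf d)$ with a fully supported Borel measure $\mu$ such that $0<\mu(B_r(x))<+\infty$ for all $x\in X$, $r>0$, where $B_r(x)=\{y\in X:\mathsf d(x,y)<r\}$. $\fint_A f\,d\mu:=\frac1{\mu(A)}\int_A f\,d\mu$. For a continuous function $u$ on $X$, $x\in X$ and $r>0$, $$\Delta^{\mathsf d}_{\mu,r}u(x):=\frac1{r^2}\fint_{B_r(x)}(u(y)-u(x))\,d\mu(y),\qquad \tilde\Delta^{\mathsf d}_{\mu,r}u(x):=\frac1{2r^2}\fint_{B_r(x)}(u(y)-u(x))\left(1+\frac{\mu(B_r(x))}{\mu(B_r(y))}\right)d\mu(y).$$ $u$ admits a pointwise AMV (resp. SAMV) Laplacian at $x$ if the finite limit $\Delta^{\mathsf d}_\mu u(x):=\lim_{r\downarrow0}\Delta^{\mathsf d}_{\mu,r}u(x)$ (resp. $\tilde\Delta^{\mathsf d}_\mu u(x):=\lim_{r\downarrow0}\tilde\Delta^{\mathsf d}_{\mu,r}u(x)$) exists. These limits only involve small balls around points close to $x$. *)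

theory Defs
  imports "HOL-Analysis.Analysis"
begin

locale metric_measure_space = Metric_space M d
  for M :: "'a set" and d :: "'a \<Rightarrow> 'a \<Rightarrow> real" +
  fixes \<mu> :: "'a measure"
  assumes space_eq: "space \<mu> = M"
    and sets_eq_borel: "sets \<mu> = sigma_sets M {U. openin mtopology U}"
    and fully_supported: "\<And>U. openin mtopology U \<Longrightarrow> U \<noteq> {} \<Longrightarrow> 0 < emeasure \<mu> U"
    and ball_pos: "\<And>x r. x \<in> M \<Longrightarrow> 0 < r \<Longrightarrow> 0 < emeasure \<mu> (mball x r)"
    and ball_finite: "\<And>x r. x \<in> M \<Longrightarrow> 0 < r \<Longrightarrow> emeasure \<mu> (mball x r) < \<infinity>"

definition average :: "'a measure \<Rightarrow> 'a set \<Rightarrow> ('a \<Rightarrow> real) \<Rightarrow> real"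
  where "average \<mu> A f = (1 / measure \<mu> A) * (LINT y:A|\<mu>. f y)"

context metric_measure_space
begin

definition AMV_approx :: "real \<Rightarrow> ('a \<Rightarrow> real) \<Rightarrow> 'a \<Rightarrow> real"
  where "AMV_approx r u x = (1 / r\<^sup>2) * average \<mu> (mball x r) (\<lambda>y. u y - u x)"

definition SAMV_approx :: "real \<Rightarrow> ('a \<Rightarrow> real) \<Rightarrow> 'a \<Rightarrow> real"
  where "SAMV_approx r u x = (1 / (2 * r\<^sup>2)) *
    average \<mu> (mball x r)
      (\<lambda>y. (u y - u x) * (1 + measure \<mu> (mball x r) / measure \<mu> (mball y r)))"

definition admits_AMV_laplacian :: "('a \<Rightarrow> real) \<Rightarrow> 'a \<Rightarrow> bool"
  where "admits_AMV_laplacian u x \<longleftrightarrow> (\<exists>L. ((\<lambda>r. AMV_approx r u x) \<longlongrightarrow> L) (at_right 0))"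

definition AMV_laplacian :: "('a \<Rightarrow> real) \<Rightarrow> 'a \<Rightarrow> real"
  where "AMV_laplacian u x = Lim (at_right 0) (\<lambda>r. AMV_approx r u x)"

definition admits_SAMV_laplacian :: "('a \<Rightarrow> real) \<Rightarrow> 'a \<Rightarrow> bool"
  where "admits_SAMV_laplacian u x \<longleftrightarrow> (\<exists>L. ((\<lambda>r. SAMV_approx r u x) \<longlongrightarrow> L) (at_right 0))"

definition SAMV_laplacian :: "('a \<Rightarrow> real) \<Rightarrow> 'a \<Rightarrow> real"
  where "SAMV_laplacian u x = Lim (at_right 0) (\<lambda>r. SAMV_approx r u x)"

end

definition partial_deriv :: "'n::finite \<Rightarrow> (real ^ 'n \<Rightarrow> real) \<Rightarrow> real ^ 'n \<Rightarrow> real"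
  where "partial_deriv i f x = deriv (\<lambda>t. f (x + t *\<^sub>R axis i 1)) 0"

definition gradient :: "(real ^ 'n::finite \<Rightarrow> real) \<Rightarrow> real ^ 'n \<Rightarrow> real ^ 'n"
  where "gradient f x = (\<chi> i. partial_deriv i f x)"

definition laplacian :: "(real ^ 'n::finite \<Rightarrow> real) \<Rightarrow> real ^ 'n \<Rightarrow> real"
  where "laplacian f x = (\<Sum>i\<in>UNIV. partial_deriv i (partial_deriv i f) x)"

text \<open>The class $C^k(S)$, meant for open \<open>S\<close>: derivatives are taken in the full space at
  points of \<open>S\<close>, and only the values of the function on \<open>S\<close> matter.\<close>

primrec Ck_on :: "nat \<Rightarrow> (real ^ 'n::finite) set \<Rightarrow> (real ^ 'n \<Rightarrow> real) \<Rightarrow> bool"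
  where
    "Ck_on 0 S f \<longleftrightarrow> continuous_on S f"
  | "Ck_on (Suc k) S f \<longleftrightarrow>
      (\<forall>x\<in>S. f differentiable (at x)) \<and> (\<forall>i. Ck_on k S (partial_deriv i f))"

text \<open>The measure on \<open>S\<close> with density \<open>w\<close> with respect to Lebesgue measure, on the Borel sets
  of \<open>S\<close>. The coercion to extended nonnegative reals replaces negative values of \<open>w\<close> by \<open>0\<close>. For
  continuous \<open>w\<close> and open \<open>S\<close> such values are excluded as soon as the measure is fully supported
  on \<open>S\<close>.\<close>

definition weighted_measure :: "(real ^ 'n::finite) set \<Rightarrow> (real ^ 'n \<Rightarrow> real) \<Rightarrow> (real ^ 'n) measure"
  where "weighted_measure S w = density (restrict_space lborel S) (\<lambda>y. ennreal (w y))"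

end

(*
Rescaling y = x + r z turns every average over B_r(x) into an integral over the unit ball B.
There u(x + r z) - u(x) = r <grad u, z> + (r^2/2) D^2u(z,z) + o(r^2) uniformly in z, and it is
multiplied by a factor G_r(z) = a + r <b, z> + o(r). The term of order r integrates to 0 by symmetry,
and since the integral of z_i z_j over B is delta_ij |B| / (n+2), the average divided by r^2 tends to
|B| / (n+2) * (a/2 Laplacian u + <grad u, b>).
For the AMV Laplacian, G_r(z) = w(x + r z) / J_r(x) where J_r(y) is the integral of w(y + r z') over
z' in B, so a = 1/|B| and b = grad w / (|B| w). In the SAMV Laplacian this is averaged with
w(x + r z) / J_r(x + r z), which equals 1/|B| + o(r): the drift of w cancels against that of J_r,
which halves the drift term.
*)
theory Submission imports Defs begin


subsection \<open>Second moments of the unit ball\<close>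

text \<open>After division by r^2 the term of order r becomes singular, of size 1/r. It must
  therefore vanish exactly and not merely in the limit, so it is split off for each fixed small r,
  and only the rest is passed to the limit. Convergence of integrands is always uniform on B: this
  is stable under products, under quotients with a nonzero limiting denominator, and under
  integration over B, and it handles averages whose centre x + r z moves with z. The cancellation in
  the SAMV case comes from the symmetry of B: J_r(x + r z) integrates w(x + r (z + z')) over z', and
  the part linear in z' has integral 0. Hence J_r(x + r z) = |B| (w(x) + r <grad w(x), z>) + o(r),
  which to first order is |B| w(x + r z). A second obstacle is locality. The functions w and u are
  arbitrary outside \<Omega>, and metric balls of \<Omega> are only traces of Euclidean balls. The
  limits are therefore computed for truncations of w and u that are Borel on the whole space, and
  for radii so small that all balls involved are Euclidean and lie where w is positive.\<close>

lemma set_integrable_bounded_on: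
  fixes f :: "'a \<Rightarrow> real"
  assumes "A \<in> sets M" "emeasure M A < \<infinity>" "f \<in> borel_measurable M" "bounded (f ` A)"
  shows "set_integrable M A f"
proof -
  obtain C where C: "\<And>x. x \<in> A \<Longrightarrow> \<bar>f x\<bar> \<le> C"
    using assms(4) by (auto simp: bounded_iff)
  show ?thesis
    unfolding set_integrable_def
    using assms(1-3) C
    by (intro integrableI_bounded_set[where A=A and B=C]) (auto simp: indicator_def)
qed

lemma emeasure_lborel_ball_finite [simp]:
  "emeasure lborel (ball c r :: 'a::euclidean_space set) < top"
  using emeasure_bounded_finite[of "ball c r"] by simp

lemma LINT_indicator_ball_diff:
  fixes c :: "'a::euclidean_space"
  assumes "0 \<le> s" "s \<le> 1"
  shows "(LINT z|lborel. indicator (ball (0::'a) 1 - ball 0 s) z) = measure lborel (ball (0::'a) 1) * (1 - s ^ DIM('a))"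
proof -
  have "(LINT z|lborel. indicator (ball (0::'a) 1 - ball 0 s) z) = measure lborel (ball (0::'a) 1 - ball 0 s)"
    by simp
  also have "\<dots> = measure lborel (ball (0::'a) 1) - measure lborel (ball (0::'a) s)"
    using assms by (intro measure_Diff) (auto simp: emeasure_lborel_ball_finite[THEN less_imp_neq, simplified])
  finally show ?thesis using assms by (simp add: content_ball algebra_simps)
qed

lemma LINT_ball_norm_squared:
  "(LINT z:ball (0::'a::euclidean_space) 1|lborel. (norm z)\<^sup>2) =
     measure lborel (ball (0::'a) 1) * (DIM('a) / (DIM('a) + 2))"
proof -
  let ?B = "ball (0::'a) 1"
  \<comment> \<open>Layer cake: \<open>|z|\<^sup>2\<close> is the integral of \<open>2 s\<close> over \<open>0 \<le> s \<le> |z|\<close>, and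
    \<open>{s \<le> |z| < 1}\<close> has volume \<open>|B| (1 - s^n)\<close>.\<close>
  define f :: "'a \<Rightarrow> real \<Rightarrow> real" where
    "f z s = (2 * s) * indicator {(z, s). z \<in> ?B \<and> 0 \<le> s \<and> s \<le> 1 \<and> s \<le> norm z} (z, s)" for z s
  have meas: "(\<lambda>p::'a \<times> real. indicator {(z, s). z \<in> ?B \<and> 0 \<le> s \<and> s \<le> 1 \<and> s \<le> norm z} p :: real)
      \<in> borel_measurable (lborel \<Otimes>\<^sub>M lborel)"
    by (measurable; simp)
  have int: "integrable (lborel \<Otimes>\<^sub>M lborel) (case_prod f)"
  proof (rule integrableI_bounded_set[where A="?B \<times> {0..1::real}" and B=2])
    show "case_prod f \<in> borel_measurable (lborel \<Otimes>\<^sub>M lborel)"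
      using meas unfolding f_def by (simp add: case_prod_beta')
    show "emeasure (lborel \<Otimes>\<^sub>M lborel) (?B \<times> {0..1::real}) < \<infinity>"
      using emeasure_lborel_ball_finite[of "0::'a" 1]
      by (subst lborel.emeasure_pair_measure_Times) (simp_all add: ennreal_mult_less_top)
  qed (auto simp: f_def indicator_def)
  have 1: "(LINT s|lborel. f z s) = indicator ?B z *\<^sub>R (norm z)\<^sup>2" for z
  proof (cases "z \<in> ?B")
    case True
    then have "f z s = 2 * (s^1 * indicator {0..norm z} s)" for s
      by (auto simp: f_def indicator_def)
    then show ?thesis using True by (simp only: integral_mult_right_zero integral_power[OF norm_ge_zero])
      (simp add: power2_eq_square)
  qed (simp add: f_def)
  \<comment> \<open>On [0,1] this is 2 s |B| (1 - s^n), written as powers times an indicator to fit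
    \<open>integral_power\<close>. Integrating it gives |B| (1 - 2/(n+2)), the source of the
    constant n + 2.\<close>
  have 2: "(LINT z|lborel. f z s) =
     measure lborel ?B * (2 * (s^1 * indicator {0..1} s) - 2 * (s ^ (DIM('a) + 1) * indicator {0..1} s))" for s
  proof (cases "0 \<le> s \<and> s \<le> 1")
    case True
    then have "f z s = 2 * s * indicator (?B - ball 0 s) z" for z
      by (auto simp: f_def indicator_def)
    then show ?thesis
      using True
      by (simp only: integral_mult_right_zero LINT_indicator_ball_diff) (simp add: algebra_simps)
  qed (auto simp: f_def indicator_def)
  have "(LINT z:?B|lborel. (norm z)\<^sup>2) = (LINT z|lborel. LINT s|lborel. f z s)"
    by (simp add: 1 set_lebesgue_integral_def)
  also have "\<dots> = (LINT s|lborel. LINT z|lborel. f z s)"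
    using lborel_pair.Fubini_integral[OF int] by simp
  also have "\<dots> = measure lborel ?B * (2 * (1 / 2) - 2 * (1 / (DIM('a) + 2)))"
  proof -
    have pow: "integrable lborel (\<lambda>s. s ^ k * indicator {0..1::real} s)" for k
      using borel_integrable_atLeastAtMost[of 0 1 "\<lambda>s. s ^ k"]
      by (simp add: indicator_def if_distrib cong: if_cong)
    show ?thesis
      unfolding 2 by (simp only: integral_mult_right_zero Bochner_Integration.integral_diff
          integrable_mult_right pow integral_power zero_le_one) simp
  qed
  also have "\<dots> = measure lborel ?B * (DIM('a) / (DIM('a) + 2))"
    by (simp add: field_simps)
  finally show ?thesis .
qed

text \<open>Lebesgue measure is determined by its values on boxes. The preimage of a box is the box
  whose corners are permuted by \<open>inv \<pi>\<close>, and its side lengths have the same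
  product.\<close>

lemma lborel_distr_vec_permute:
  fixes \<pi> :: "'n::finite \<Rightarrow> 'n"
  assumes "bij \<pi>"
  shows "distr lborel borel (\<lambda>z::real^'n. \<chi> i. z $ \<pi> i) = lborel"
proof (rule lborel_eqI[symmetric])
  let ?T = "\<lambda>z::real^'n. \<chi> i. z $ \<pi> i"
  let ?S = "\<lambda>z::real^'n. \<chi> i. z $ inv \<pi> i"
  have meas: "?T \<in> borel_measurable borel"
    by (intro borel_measurable_continuous_onI continuous_intros)
  fix l u :: "real^'n"
  assume le: "\<And>b. b \<in> Basis \<Longrightarrow> l \<bullet> b \<le> u \<bullet> b"
  have le': "l $ i \<le> u $ i" for i
    using le[of "axis i 1"] by (simp add: inner_axis)
  have vim: "?T -` box l u = box (?S l) (?S u)"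
    using bij_is_surj[OF assms] bij_is_inj[OF assms]
    by (auto simp: mem_box_cart) (metis surj_f_inv_f inv_f_f)+
  have B: "(\<Prod>b\<in>Basis. (b' :: real^'n) \<bullet> b) = (\<Prod>i\<in>UNIV. b' $ i)" for b'
    by (simp add: Basis_vec_def UNION_singleton_eq_range prod.reindex inj_on_def axis_eq_axis inner_axis)
  have "emeasure (distr lborel borel ?T) (box l u) = emeasure lborel (box (?S l) (?S u))"
    using meas by (subst emeasure_distr) (auto simp: vim)
  also have "\<dots> = (\<Prod>b\<in>Basis. (?S u - ?S l) \<bullet> b)"
    by (rule emeasure_lborel_box) (auto simp: Basis_vec_def inner_axis le')
  also have "\<dots> = (\<Prod>i\<in>UNIV. (u - l) $ inv \<pi> i)"
    unfolding B by simp
  also have "\<dots> = (\<Prod>i\<in>UNIV. (u - l) $ i)"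
    using prod.reindex_bij_betw[OF bij_imp_bij_inv[OF assms], of "\<lambda>i. (u - l) $ i"] by simp
  finally show "emeasure (distr lborel borel ?T) (box l u) = (\<Prod>b\<in>Basis. (u - l) \<bullet> b)"
    unfolding B .
qed simp

text \<open>The map flips the sign of coordinate \<open>i\<close>. It is a diagonal linear map with
  entries 1 and -1, so its Jacobian factor is 1.\<close>

lemma lborel_distr_vec_reflect:
  fixes i :: "'n::finite"
  shows "distr lborel borel (\<lambda>z::real^'n. z - (2 * z $ i) *\<^sub>R axis i 1) = lborel"
proof -
  define c :: "real^'n \<Rightarrow> real" where "c b = (if b = axis i 1 then - 1 else 1)" for b
  have eq: "0 + (\<Sum>j\<in>Basis. (c j * (z \<bullet> j)) *\<^sub>R j) = z - (2 * z $ i) *\<^sub>R axis i 1" for z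
  proof -
    have "(\<Sum>j\<in>Basis. (c j * (z \<bullet> j)) *\<^sub>R j) =
        (\<Sum>j\<in>Basis. (z \<bullet> j) *\<^sub>R j - (if j = axis i 1 then (2 * (z \<bullet> j)) *\<^sub>R j else 0))"
      by (intro sum.cong) (auto simp: c_def scaleR_2 algebra_simps simp flip: scaleR_scaleR)
    also have "\<dots> = z - (2 * z $ i) *\<^sub>R axis i 1"
      by (simp add: sum_subtractf euclidean_representation axis_in_Basis_iff inner_axis)
    finally show ?thesis by simp
  qed
  have "lborel = density (distr lborel borel (\<lambda>x. 0 + (\<Sum>j\<in>Basis. (c j * (x \<bullet> j)) *\<^sub>R j)))
      (\<lambda>_. (\<Prod>j\<in>Basis. \<bar>c j\<bar>))"
    by (rule lborel_affine_euclidean) (auto simp: c_def)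
  moreover have c1: "\<bar>c j\<bar> = 1" for j
    by (simp add: c_def)
  ultimately show ?thesis
    using c1 unfolding eq by (simp add: density_1)
qed

lemma LINT_ball_invariant:
  fixes T :: "'a::euclidean_space \<Rightarrow> 'a" and f :: "'a \<Rightarrow> real"
  assumes "distr lborel borel T = lborel" "T \<in> borel_measurable borel" "\<And>z. norm (T z) = norm z"
    and "f \<in> borel_measurable borel"
  shows "(LINT z:ball 0 r|lborel. f (T z)) = (LINT z:ball 0 r|lborel. f z)"
proof -
  have "(LINT z:ball 0 r|lborel. f z) = (LINT z|distr lborel borel T. indicator (ball 0 r) z * f z)"
    unfolding assms(1) set_lebesgue_integral_def by simp
  also have "\<dots> = (LINT z|lborel. indicator (ball 0 r) (T z) * f (T z))"
    using assms(2,4) by (intro integral_distr borel_measurable_times borel_measurable_indicator) auto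
  also have "\<dots> = (LINT z:ball 0 r|lborel. f (T z))"
    unfolding set_lebesgue_integral_def by (simp add: indicator_def assms(3))
  finally show ?thesis ..
qed

lemma norm_vec_reflect: "norm (z - (2 * z $ i) *\<^sub>R axis i (1::real)) = norm (z::real^'n::finite)"
  by (simp add: norm_eq_sqrt_inner inner_diff inner_axis inner_axis' algebra_simps)

lemma norm_vec_permute:
  assumes "bij \<pi>" shows "norm (\<chi> i. z $ \<pi> i) = norm (z::real^'n::finite)"
  using sum.reindex_bij_betw[OF assms, of "\<lambda>i. (norm (z $ i))\<^sup>2"]
  by (simp add: norm_vec_def L2_set_def)

text \<open>Reflecting coordinate \<open>i\<close> turns the integrand into its negative.\<close>

lemma LINT_ball_component:
  "(LINT z:ball (0::real^'n::finite) 1|lborel. z $ i) = 0"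
proof -
  have "(LINT z:ball (0::real^'n) 1|lborel. (z - (2 * z $ i) *\<^sub>R axis i 1) $ i)
      = (LINT z:ball (0::real^'n) 1|lborel. z $ i)"
    by (rule LINT_ball_invariant[OF lborel_distr_vec_reflect _ norm_vec_reflect])
      (auto intro!: borel_measurable_continuous_onI continuous_intros)
  then show ?thesis by (simp add: axis_def set_integral_uminus set_lebesgue_integral_def)
qed

text \<open>For distinct indices, reflecting coordinate \<open>i\<close> changes the sign of the
  product. For equal indices, transpositions show that all n squared coordinates have the same
  integral, and together they give the integral |B| n/(n+2) of the squared norm.\<close>

lemma LINT_ball_component_mult:
  "(LINT z:ball (0::real^'n::finite) 1|lborel. z $ i * z $ j) =
     (if i = j then measure lborel (ball (0::real^'n) 1) / (CARD('n) + 2) else 0)"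
proof (cases "i = j")
  case False
  have "(LINT z:ball (0::real^'n) 1|lborel. (z - (2 * z $ i) *\<^sub>R axis i 1) $ i * (z - (2 * z $ i) *\<^sub>R axis i 1) $ j)
      = (LINT z:ball (0::real^'n) 1|lborel. z $ i * z $ j)"
    by (rule LINT_ball_invariant[OF lborel_distr_vec_reflect _ norm_vec_reflect, where f="\<lambda>z. z $ i * z $ j"])
      (auto intro!: borel_measurable_continuous_onI continuous_intros)
  then show ?thesis using False by (simp add: axis_def set_lebesgue_integral_def)
next
  case True
  let ?B = "ball (0::real^'n) 1"
  have swap: "(LINT z:?B|lborel. (z $ k)\<^sup>2) = (LINT z:?B|lborel. (z $ i)\<^sup>2)" for k
  proof -
    let ?\<pi> = "Transposition.transpose i k"
    have \<pi>: "bij ?\<pi>" by simp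
    have "(\<lambda>z::real^'n. \<chi> j. z $ ?\<pi> j) \<in> borel_measurable borel"
      by (intro borel_measurable_continuous_onI continuous_intros)
    from LINT_ball_invariant[OF lborel_distr_vec_permute[OF \<pi>] this norm_vec_permute[OF \<pi>], of "\<lambda>z. (z $ i)\<^sup>2" 1]
    show ?thesis
      by (auto intro!: borel_measurable_continuous_onI continuous_intros)
  qed
  have "set_integrable lborel ?B (\<lambda>z. (z $ k)\<^sup>2)" for k
  proof (rule set_integrable_bounded_on)
    have "\<bar>(z $ k)\<^sup>2\<bar> \<le> 1" if "z \<in> ?B" for z
      using that component_le_norm_cart[of z k] abs_square_le_1[of "z$k"] by simp
    then show "bounded ((\<lambda>z. (z $ k)\<^sup>2) ` ?B)" by (auto simp: bounded_iff intro!: exI[of _ 1])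
  qed (auto intro!: borel_measurable_continuous_onI continuous_intros)
  moreover have "(norm z)\<^sup>2 = (\<Sum>k\<in>UNIV. (z $ k)\<^sup>2)" for z :: "real^'n"
    unfolding power2_norm_eq_inner inner_vec_def by (simp add: power2_eq_square)
  ultimately have "(LINT z:?B|lborel. (norm z)\<^sup>2) = (\<Sum>k\<in>UNIV. LINT z:?B|lborel. (z $ k)\<^sup>2)"
    unfolding set_lebesgue_integral_def set_integrable_def
    by (simp only: scaleR_sum_right Bochner_Integration.integral_sum)
  also have "\<dots> = CARD('n) * (LINT z:?B|lborel. (z $ i)\<^sup>2)"
    by (subst sum.cong[OF refl swap]) simp_all
  finally have "CARD('n) * (LINT z:?B|lborel. (z $ i)\<^sup>2) = CARD('n) * (measure lborel ?B / (CARD('n) + 2))"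
    unfolding LINT_ball_norm_squared by (simp add: mult.commute)
  then have "(LINT z:?B|lborel. (z $ i)\<^sup>2) = measure lborel ?B / (CARD('n) + 2)"
    by (subst (asm) mult_left_cancel) auto
  then show ?thesis
    using True by (simp add: power2_eq_square)
qed


subsection \<open>Integrals of uniform limits\<close>

text \<open>Provides integrability of the approximants on sets of finite measure, which
  \<open>second_order_average_limit\<close> needs before it may split an integral at fixed
  r.\<close>

lemma uniform_limit_imp_eventually_bounded:
  fixes g :: "'a \<Rightarrow> real"
  assumes "uniform_limit S f g F" "bounded (g ` S)"
  shows "\<forall>\<^sub>F r in F. bounded (f r ` S)"
proof -
  obtain C where C: "\<And>x. x \<in> S \<Longrightarrow> \<bar>g x\<bar> \<le> C"
    using assms(2) by (auto simp: bounded_iff)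
  show ?thesis
    using uniform_limitD[OF assms(1) zero_less_one]
  proof eventually_elim
    case (elim r)
    have "\<bar>f r x\<bar> \<le> C + 1" if "x \<in> S" for x
      using elim[rule_format, OF that] C[OF that] by (simp add: dist_real_def)
    then show ?case by (auto simp: bounded_iff)
  qed
qed

text \<open>The parameter \<open>z\<close> serves for ball averages with moving centre, whose
  expansion must be uniform in the centre. Integrability of \<open>f r z\<close> is not assumed: it
  follows once \<open>f r z\<close> is close to the bounded \<open>g z\<close>.\<close>

lemma uniform_limit_set_lebesgue_integral:
  fixes f :: "'r \<Rightarrow> 'b \<Rightarrow> 'a \<Rightarrow> real"
  assumes S: "S \<in> sets M" "emeasure M S < \<infinity>"
    and meas: "\<And>r z. z \<in> A \<Longrightarrow> f r z \<in> borel_measurable M" "\<And>z. z \<in> A \<Longrightarrow> g z \<in> borel_measurable M"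
    and bdd: "\<And>z. z \<in> A \<Longrightarrow> bounded (g z ` S)"
    and lim: "uniform_limit (A \<times> S) (\<lambda>r (z, y). f r z y) (\<lambda>(z, y). g z y) F"
  shows "uniform_limit A (\<lambda>r z. LINT y:S|M. f r z y) (\<lambda>z. LINT y:S|M. g z y) F"
proof (rule uniform_limitI)
  fix e :: real assume e: "0 < e"
  \<comment> \<open>The summand 1 keeps the quotient meaningful when \<open>S\<close> is a null set
    and makes \<open>d * measure M S < e\<close> strict.\<close>
  define d where "d = e / (measure M S + 1)"
  have "0 < measure M S + 1" using measure_nonneg[of M S] by linarith
  then have d: "0 < d" "d * measure M S < e"
    using e by (auto simp: d_def field_simps)
  show "\<forall>\<^sub>F r in F. \<forall>z\<in>A. dist (LINT y:S|M. f r z y) (LINT y:S|M. g z y) < e"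
    using uniform_limitD[OF lim d(1)]
  proof eventually_elim
    case (elim r)
    show ?case
    proof
      fix z assume z: "z \<in> A"
      have close: "\<bar>f r z y - g z y\<bar> < d" if "y \<in> S" for y
        using elim z that by (fastforce simp: dist_real_def)
      have ig: "set_integrable M S (g z)"
        using S meas(2)[OF z] bdd[OF z] by (rule set_integrable_bounded_on)
      have id: "set_integrable M S (\<lambda>y. f r z y - g z y)"
        using S meas[OF z] close
        by (intro set_integrable_bounded_on borel_measurable_diff)
          (auto simp: bounded_iff intro!: exI[of _ d] less_imp_le)
      have "set_integrable M S (\<lambda>y. (f r z y - g z y) + g z y)"
        using id ig by (rule set_integral_add)
      then have if': "set_integrable M S (f r z)" by simp
      have ic: "set_integrable M S (\<lambda>_. d)"
        using S by (intro set_integrable_bounded_on) (auto simp: bounded_iff)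
      have "\<bar>(LINT y:S|M. f r z y) - (LINT y:S|M. g z y)\<bar> = \<bar>LINT y:S|M. f r z y - g z y\<bar>"
        using if' ig by (simp add: set_integral_diff)
      also have "\<dots> \<le> (LINT y:S|M. \<bar>f r z y - g z y\<bar>)"
        unfolding set_lebesgue_integral_def
        using integral_abs_bound[of M "\<lambda>y. indicator S y *\<^sub>R (f r z y - g z y)"] by (simp add: abs_mult)
      also have "\<dots> \<le> (LINT y:S|M. d)"
        using set_integrable_abs[OF id] ic close by (intro set_integral_mono) (auto intro: less_imp_le)
      also have "\<dots> = d * measure M S"
        using S by (simp add: set_integral_const)
      finally show "dist (LINT y:S|M. f r z y) (LINT y:S|M. g z y) < e"
        using d(2) by (simp add: dist_real_def)
    qed
  qed
qed

lemma tendsto_set_lebesgue_integral: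
  fixes f :: "'r \<Rightarrow> 'a \<Rightarrow> real"
  assumes "S \<in> sets M" "emeasure M S < \<infinity>" "\<And>r. f r \<in> borel_measurable M" "g \<in> borel_measurable M"
    and "bounded (g ` S)" and lim: "uniform_limit S f g F"
  shows "((\<lambda>r. LINT y:S|M. f r y) \<longlongrightarrow> (LINT y:S|M. g y)) F"
proof -
  \<comment> \<open>The version without parameter is the case of a one-point parameter set.\<close>
  have "uniform_limit ({()} \<times> S) (\<lambda>r (z, y). f r y) (\<lambda>(z, y). g y) F"
    using uniform_limit_compose'[OF lim, of snd "{()} \<times> S"] by (simp add: case_prod_beta' Pi_iff)
  then have "uniform_limit {()} (\<lambda>r z. LINT y:S|M. f r y) (\<lambda>z. LINT y:S|M. g y) F"
    using assms by (intro uniform_limit_set_lebesgue_integral) auto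
  then show ?thesis by simp
qed

text \<open>The error of differentiability at a point is small relative to the length r |z| of the
  increment. For \<open>z\<close> in a bounded set that length is at most a constant times r, so one
  radius serves all directions.\<close>

lemma has_derivative_imp_uniform_limit:
  fixes f :: "'a::real_normed_vector \<Rightarrow> real"
  assumes f: "(f has_derivative f') (at x)" and "bounded S"
  shows "uniform_limit S (\<lambda>r z. (f (x + r *\<^sub>R z) - f x) / r) f' (at_right 0)"
proof (rule uniform_limitI)
  fix e :: real assume e: "0 < e"
  obtain C where C: "0 < C" "\<And>z. z \<in> S \<Longrightarrow> norm z \<le> C"
    using \<open>bounded S\<close> by (auto simp: bounded_pos)
  interpret f': bounded_linear f' using f by (rule has_derivative_bounded_linear)
  \<comment> \<open>Division by \<open>C\<close> absorbs the bound on the norms; the factor 2 turns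
    the non-strict derivative estimate into a strict one.\<close>
  have "0 < e / (2 * C)" using e C by simp
  then obtain d where d: "0 < d"
    "\<And>y. norm (y - x) < d \<Longrightarrow> norm (f y - f x - f' (y - x)) \<le> e / (2 * C) * norm (y - x)"
    using f unfolding has_derivative_at_alt by blast
  have "\<forall>\<^sub>F r in at_right 0. r \<in> {0<..<d / C}"
    using d C by (intro eventually_at_right_real) simp
  then show "\<forall>\<^sub>F r in at_right 0. \<forall>z\<in>S. dist ((f (x + r *\<^sub>R z) - f x) / r) (f' z) < e"
  proof eventually_elim
    case (elim r)
    show ?case
    proof
      fix z assume z: "z \<in> S"
      have r: "0 < r" "r * C < d" using elim C by (auto simp: field_simps)
      have rz: "r * norm z \<le> r * C" using C(2)[OF z] r by simp
      have "dist ((f (x + r *\<^sub>R z) - f x) / r) (f' z) = \<bar>f (x + r *\<^sub>R z) - f x - f' (r *\<^sub>R z)\<bar> / r"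
        using r by (simp add: dist_real_def f'.scaleR field_simps abs_divide flip: abs_mult_pos)
      also have "\<dots> \<le> (e / (2 * C) * (r * norm z)) / r"
        using d(2)[of "x + r *\<^sub>R z"] r rz by (intro divide_right_mono) auto
      also have "\<dots> \<le> (e / (2 * C) * (r * C)) / r"
        using rz r e C by (intro divide_right_mono mult_left_mono) auto
      also have "\<dots> < e" using r e C by simp
      finally show "dist ((f (x + r *\<^sub>R z) - f x) / r) (f' z) < e" .
    qed
  qed
qed

lemma bounded_image_ball_continuous:
  fixes f :: "'a::euclidean_space \<Rightarrow> real"
  assumes "continuous_on UNIV f"
  shows "bounded (f ` ball c r)"
proof -
  have "bounded (f ` cball c r)"
    using assms by (intro compact_imp_bounded compact_continuous_image) (auto intro: continuous_on_subset)
  then show ?thesis by (rule bounded_subset) auto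
qed

section \<open>Moments of polynomials and limits of rescaled averages over the unit ball\<close>

text \<open>Only the diagonal moments survive, so a quadratic form integrates to a multiple of its
  trace. The trace of the Hessian gives the Laplacian, and the trace of the matrix p_i b_j gives the
  drift term.\<close>

lemma LINT_ball_quadratic:
  fixes A :: "'n::finite \<Rightarrow> 'n \<Rightarrow> real"
  shows "(LINT z:ball (0::real^'n) 1|lborel. (\<Sum>i\<in>UNIV. \<Sum>j\<in>UNIV. A i j * (z $ i * z $ j))) =
    measure lborel (ball (0::real^'n) 1) / (CARD('n) + 2) * (\<Sum>i\<in>UNIV. A i i)"
proof -
  let ?B = "ball (0::real^'n) 1"
  have int: "integrable lborel (\<lambda>z. indicator ?B z * (z $ i * z $ j))" for i j
  proof -
    have c: "continuous_on UNIV (\<lambda>z::real^'n. z $ i * z $ j)"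
      by (intro continuous_intros)
    then have "set_integrable lborel ?B (\<lambda>z. z $ i * z $ j)"
      by (intro set_integrable_bounded_on bounded_image_ball_continuous)
        (auto simp: borel_measurable_continuous_onI)
    then show ?thesis by (simp add: set_integrable_def)
  qed
  have "(LINT z:?B|lborel. (\<Sum>i\<in>UNIV. \<Sum>j\<in>UNIV. A i j * (z $ i * z $ j))) =
      (LINT z|lborel. (\<Sum>i\<in>UNIV. \<Sum>j\<in>UNIV. A i j * (indicator ?B z * (z $ i * z $ j))))"
    unfolding set_lebesgue_integral_def by (simp add: sum_distrib_left algebra_simps)
  also have "\<dots> = (\<Sum>i\<in>UNIV. \<Sum>j\<in>UNIV. A i j * (LINT z|lborel. indicator ?B z * (z $ i * z $ j)))"
    using int by (simp add: Bochner_Integration.integral_sum)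
  also have "\<dots> = (\<Sum>i\<in>UNIV. \<Sum>j\<in>UNIV. A i j * (LINT z:?B|lborel. z $ i * z $ j))"
    by (simp add: set_lebesgue_integral_def)
  also have "\<dots> = measure lborel ?B / (CARD('n) + 2) * (\<Sum>i\<in>UNIV. A i i)"
    by (simp add: LINT_ball_component_mult sum_distrib_left sum_divide_distrib if_distrib mult.commute cong: if_cong)
  finally show ?thesis .
qed

lemma LINT_ball_linear:
  "set_integrable lborel (ball (0::real^'n::finite) 1) (\<lambda>z. p \<bullet> z)"
  "(LINT z:ball (0::real^'n::finite) 1|lborel. p \<bullet> z) = 0"
proof -
  let ?B = "ball (0::real^'n) 1"
  have int: "set_integrable lborel ?B (\<lambda>z. f z)" if "continuous_on UNIV f" for f :: "real^'n \<Rightarrow> real"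
    using that by (intro set_integrable_bounded_on bounded_image_ball_continuous)
      (auto simp: borel_measurable_continuous_onI)
  show "set_integrable lborel ?B (\<lambda>z. p \<bullet> z)"
    by (intro int continuous_intros)
  have i: "integrable lborel (\<lambda>z. indicator ?B z * z $ i)" for i
    using int[of "\<lambda>z. z $ i"] by (simp add: set_integrable_def continuous_intros)
  have "(LINT z:?B|lborel. p \<bullet> z) = (LINT z|lborel. (\<Sum>i\<in>UNIV. p $ i * (indicator ?B z * z $ i)))"
    unfolding set_lebesgue_integral_def by (simp add: inner_vec_def sum_distrib_left algebra_simps)
  also have "\<dots> = (\<Sum>i\<in>UNIV. p $ i * (LINT z|lborel. indicator ?B z * z $ i))"
    using i by (simp add: Bochner_Integration.integral_sum)
  also have "\<dots> = 0"
    by (simp add: LINT_ball_component[unfolded set_lebesgue_integral_def real_scaleR_def])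
  finally show "(LINT z:?B|lborel. p \<bullet> z) = 0" .
qed

text \<open>Common core of both Laplacians, which differ only in the weight \<open>G\<close> and
  hence in \<open>b\<close>. An expansion of \<open>G\<close> to first order suffices, because it
  multiplies an increment of \<open>U\<close> that is itself of order r.\<close>

lemma second_order_average_limit:
  fixes x p b :: "real^'n::finite" and U :: "real^'n \<Rightarrow> real" and G :: "real \<Rightarrow> real^'n \<Rightarrow> real"
    and a :: real and A :: "'n \<Rightarrow> 'n \<Rightarrow> real"
  defines "B \<equiv> ball (0::real^'n) 1"
  assumes meas: "U \<in> borel_measurable borel" "\<And>r. G r \<in> borel_measurable borel"
    and U: "uniform_limit B (\<lambda>r z. (U (x + r *\<^sub>R z) - U x - r * (p \<bullet> z)) / r\<^sup>2)
      (\<lambda>z. (\<Sum>i\<in>UNIV. \<Sum>j\<in>UNIV. A i j * (z $ i * z $ j)) / 2) (at_right 0)"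
    and G: "uniform_limit B (\<lambda>r z. (G r z - a) / r) (\<lambda>z. b \<bullet> z) (at_right 0)"
  shows "((\<lambda>r. (1 / r\<^sup>2) * (LINT z:B|lborel. (U (x + r *\<^sub>R z) - U x) * G r z)) \<longlongrightarrow>
    measure lborel B / (CARD('n) + 2) * (a * (\<Sum>i\<in>UNIV. A i i) / 2 + p \<bullet> b)) (at_right 0)"
proof -
  let ?Q = "\<lambda>z::real^'n. (\<Sum>i\<in>UNIV. \<Sum>j\<in>UNIV. A i j * (z $ i * z $ j)) / 2"
  define Q where "Q r z = (U (x + r *\<^sub>R z) - U x - r * (p \<bullet> z)) / r\<^sup>2" for r z
  define E where "E r z = (G r z - a) / r" for r z
  \<comment> \<open>The rescaled integrand is \<open>\<psi> r z + (a / r) (p \<bullet> z)\<close>; the singular second term has integral \<open>0\<close>.\<close>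
  define \<psi> where "\<psi> r z = a * Q r z + (p \<bullet> z) * E r z + r * (Q r z * E r z)" for r z
  \<comment> \<open>The summand with factor 0 is kept so that the limit has literally the shape
    produced by the sum and product rules for uniform limits.\<close>
  define \<psi>0 where "\<psi>0 z = a * ?Q z + (p \<bullet> z) * (b \<bullet> z) + 0 * (?Q z * (b \<bullet> z))" for z
  have bdd: "bounded (f ` B)" if "continuous_on UNIV f" for f :: "real^'n \<Rightarrow> real"
    unfolding B_def using that by (rule bounded_image_ball_continuous)
  have [measurable]: "(\<lambda>z. U (x + r *\<^sub>R z)) \<in> borel_measurable borel" for r
    using meas(1) by measurable
  note [measurable] = meas(2)
  have \<psi>_meas: "\<psi> r \<in> borel_measurable lborel" for r
    unfolding \<psi>_def Q_def E_def by measurable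
  have c0: "continuous_on UNIV \<psi>0"
    unfolding \<psi>0_def by (intro continuous_intros) auto
  have lim_Q: "uniform_limit B Q ?Q (at_right 0)" using U by (simp add: Q_def[abs_def])
  have lim_E: "uniform_limit B E (\<lambda>z. b \<bullet> z) (at_right 0)" using G by (simp add: E_def[abs_def])
  have lim_r: "uniform_limit B (\<lambda>r z. r) (\<lambda>z. 0::real) (at_right 0)"
    by (auto simp: uniform_limit_iff eventually_at dist_real_def)
  have "uniform_limit B \<psi> \<psi>0 (at_right 0)"
    unfolding \<psi>_def \<psi>0_def
    by (intro uniform_limit_add uniform_lim_mult uniform_limit_const lim_Q lim_E lim_r bdd continuous_intros) auto
  then have "((\<lambda>r. LINT z:B|lborel. \<psi> r z) \<longlongrightarrow> (LINT z:B|lborel. \<psi>0 z)) (at_right 0)"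
    using c0 \<psi>_meas by (intro tendsto_set_lebesgue_integral bdd) (auto simp: B_def borel_measurable_continuous_onI)
  moreover have "(LINT z:B|lborel. \<psi>0 z) = measure lborel B / (CARD('n) + 2) * (a * (\<Sum>i\<in>UNIV. A i i) / 2 + p \<bullet> b)"
  proof -
    \<comment> \<open>Both surviving terms merge into one quadratic form, with coefficients a A_ij /
      2 + p_i b_j.\<close>
    have "\<psi>0 z = (\<Sum>i\<in>UNIV. \<Sum>j\<in>UNIV. (a * A i j / 2 + p $ i * b $ j) * (z $ i * z $ j))" for z
      unfolding \<psi>0_def
      by (simp add: inner_vec_def sum_product sum_distrib_left sum_divide_distrib distrib_right sum.distrib algebra_simps)
    then show ?thesis
      unfolding B_def using LINT_ball_quadratic[of "\<lambda>i j. a * A i j / 2 + p $ i * b $ j"]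
      by (simp add: sum.distrib inner_vec_def sum_distrib_left sum_divide_distrib)
  qed
  moreover have "\<forall>\<^sub>F r in at_right 0. (LINT z:B|lborel. \<psi> r z) = (1 / r\<^sup>2) * (LINT z:B|lborel. (U (x + r *\<^sub>R z) - U x) * G r z)"
  proof -
    have "\<forall>\<^sub>F r in at_right 0. bounded (\<psi> r ` B)"
      using \<open>uniform_limit B \<psi> \<psi>0 (at_right 0)\<close> bdd[OF c0] by (rule uniform_limit_imp_eventually_bounded)
    then show ?thesis
      using eventually_at_right_less[of "0::real"]
    proof eventually_elim
      case (elim r)
      have int\<psi>: "set_integrable lborel B (\<psi> r)"
        using elim \<psi>_meas by (intro set_integrable_bounded_on) (auto simp: B_def)
      have intp: "set_integrable lborel B (\<lambda>z. a / r * (p \<bullet> z))"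
        unfolding B_def by (intro set_integrable_mult_right LINT_ball_linear)
      have "(LINT z:B|lborel. \<psi> r z) = (LINT z:B|lborel. \<psi> r z + a / r * (p \<bullet> z))"
        unfolding set_integral_add(2)[OF int\<psi> intp] using LINT_ball_linear(2)[of p] by (simp add: B_def)
      also have "(\<lambda>z. \<psi> r z + a / r * (p \<bullet> z)) = (\<lambda>z. (1 / r\<^sup>2) * ((U (x + r *\<^sub>R z) - U x) * G r z))"
        using elim unfolding \<psi>_def Q_def E_def
        by (auto simp: fun_eq_iff field_simps power2_eq_square)
      finally show ?case by simp
    qed
  qed
  ultimately show ?thesis
    by (simp add: filterlim_cong[OF refl refl] tendsto_cong)
qed


subsection \<open>Gradients and Taylor expansion\<close>

lemma partial_deriv_eq:
  assumes "(f has_derivative f') (at x)"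
  shows "partial_deriv i f x = f' (axis i 1)"
proof -
  interpret f': bounded_linear f' using assms by (rule has_derivative_bounded_linear)
  have "((\<lambda>t. x + t *\<^sub>R axis i 1) has_derivative (\<lambda>t. t *\<^sub>R axis i 1)) (at 0)"
    by (auto intro!: derivative_eq_intros)
  then have "((\<lambda>t. f (x + t *\<^sub>R axis i 1)) has_derivative (\<lambda>t. f' (t *\<^sub>R axis i 1))) (at 0)"
    by (rule has_derivative_compose) (use assms in simp)
  then have "((\<lambda>t. f (x + t *\<^sub>R axis i 1)) has_field_derivative f' (axis i 1)) (at 0)"
    unfolding has_field_derivative_def
    by (rule has_derivative_eq_rhs) (simp add: fun_eq_iff f'.scaleR)
  then show ?thesis unfolding partial_deriv_def by (rule DERIV_imp_deriv)
qed

lemma has_derivative_gradient: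
  assumes "f differentiable (at x)"
  shows "(f has_derivative (\<lambda>h. gradient f x \<bullet> h)) (at x)"
proof -
  obtain f' where f': "(f has_derivative f') (at x)"
    using assms by (auto simp: differentiable_def)
  interpret f': bounded_linear f' using f' by (rule has_derivative_bounded_linear)
  have "f' h = gradient f x \<bullet> h" for h
  proof -
    have "f' h = f' (\<Sum>i\<in>UNIV. h $ i *\<^sub>R axis i 1)"
      using basis_expansion[of h] by (simp add: scalar_mult_eq_scaleR)
    also have "\<dots> = gradient f x \<bullet> h"
      by (simp add: f'.sum f'.scaleR gradient_def inner_vec_def partial_deriv_eq[OF f'] mult.commute)
    finally show ?thesis .
  qed
  then have "f' = (\<lambda>h. gradient f x \<bullet> h)" by blast
  with f' show ?thesis by simp
qed

lemma gradient_ln: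
  assumes "w differentiable (at x)" "0 < w x"
  shows "gradient (\<lambda>y. ln (w y)) x = (1 / w x) *\<^sub>R gradient w x"
proof -
  have "((\<lambda>y. ln (w y)) has_derivative (\<lambda>h. (gradient w x \<bullet> h) * inverse (w x))) (at x)"
    using has_derivative_gradient[OF assms(1)] assms(2) by (auto intro!: derivative_eq_intros)
  from partial_deriv_eq[OF this] show ?thesis
    by (simp add: gradient_def vec_eq_iff inner_axis divide_inverse mult.commute)
qed

lemma DERIV_along_line:
  fixes f :: "real^'n::finite \<Rightarrow> real"
  assumes "f differentiable (at (x + t *\<^sub>R h))"
  shows "((\<lambda>t. f (x + t *\<^sub>R h)) has_field_derivative (\<Sum>i\<in>UNIV. partial_deriv i f (x + t *\<^sub>R h) * h $ i)) (at t)"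
proof -
  have "((\<lambda>t. x + t *\<^sub>R h) has_derivative (\<lambda>s. s *\<^sub>R h)) (at t)"
    by (auto intro!: derivative_eq_intros)
  then have "((\<lambda>t. f (x + t *\<^sub>R h)) has_derivative (\<lambda>s. gradient f (x + t *\<^sub>R h) \<bullet> (s *\<^sub>R h))) (at t)"
    by (rule has_derivative_compose) (use has_derivative_gradient[OF assms] in simp)
  then show ?thesis
    unfolding has_field_derivative_def
    by (rule has_derivative_eq_rhs)
      (auto simp: fun_eq_iff gradient_def inner_vec_def sum_distrib_left sum_distrib_right mult_ac intro!: sum.cong)
qed

text \<open>Maclaurin's formula with Lagrange remainder for the restriction of \<open>u\<close> to
  the segment from \<open>x\<close> to \<open>x + h\<close>; the function \<open>D\<close> below
  lists its derivatives of order 0, 1 and 2.\<close>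

lemma Taylor_second_order:
  fixes u :: "real^'n::finite \<Rightarrow> real"
  assumes u: "Ck_on 2 S u" and seg: "\<And>t. 0 \<le> t \<Longrightarrow> t \<le> 1 \<Longrightarrow> x + t *\<^sub>R h \<in> S"
  obtains t where "0 < t" "t < 1"
    "u (x + h) = u x + gradient u x \<bullet> h
      + (\<Sum>i\<in>UNIV. \<Sum>j\<in>UNIV. partial_deriv j (partial_deriv i u) (x + t *\<^sub>R h) * (h $ i * h $ j)) / 2"
proof -
  have d1: "u differentiable (at y)" and d2: "partial_deriv i u differentiable (at y)" if "y \<in> S" for y i
    using u that by (auto simp: numeral_2_eq_2)
  define D :: "nat \<Rightarrow> real \<Rightarrow> real" where "D m t =
    (if m = 0 then u (x + t *\<^sub>R h)
     else if m = 1 then \<Sum>i\<in>UNIV. partial_deriv i u (x + t *\<^sub>R h) * h $ i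
     else \<Sum>i\<in>UNIV. (\<Sum>j\<in>UNIV. partial_deriv j (partial_deriv i u) (x + t *\<^sub>R h) * h $ j) * h $ i)" for m t
  have "DERIV (D m) t :> D (Suc m) t" if "m < 2" "0 \<le> t" "t \<le> 1" for m t
  proof -
    have S: "x + t *\<^sub>R h \<in> S" using seg that by simp
    consider "m = 0" | "m = 1" using \<open>m < 2\<close> by linarith
    then show ?thesis
    proof cases
      case 1
      then show ?thesis using DERIV_along_line[OF d1[OF S]] by (simp add: D_def[abs_def])
    next
      case 2
      then show ?thesis using DERIV_along_line[OF d2[OF S]]
        by (auto simp: D_def[abs_def] intro!: DERIV_sum DERIV_cmult_right)
    qed
  qed
  then obtain t where t: "0 < t" "t < 1"
    "D 0 1 = (\<Sum>m<2. (D m 0 / fact m) * 1 ^ m) + (D 2 t / fact 2) * 1 ^ 2"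
    using Maclaurin[of 1 2 D "D 0"] by auto
  show ?thesis
  proof (rule that[OF t(1,2)])
    show "u (x + h) = u x + gradient u x \<bullet> h
      + (\<Sum>i\<in>UNIV. \<Sum>j\<in>UNIV. partial_deriv j (partial_deriv i u) (x + t *\<^sub>R h) * (h $ i * h $ j)) / 2"
      using t(3) by (simp add: D_def numeral_2_eq_2 gradient_def inner_vec_def sum_distrib_right sum_distrib_left mult_ac)
  qed
qed

text \<open>By the Lagrange form, the rescaled remainder is exactly half the Hessian form at an
  intermediate point. That point depends on r and z but lies within distance r of \<open>x\<close>,
  so continuity of the second partials at \<open>x\<close> gives uniformity.\<close>

lemma uniform_limit_Taylor_second_order:
  fixes u :: "real^'n::finite \<Rightarrow> real"
  assumes "open S" "x \<in> S" and u: "Ck_on 2 S u"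
  shows "uniform_limit (ball 0 1) (\<lambda>r z. (u (x + r *\<^sub>R z) - u x - r * (gradient u x \<bullet> z)) / r\<^sup>2)
    (\<lambda>z. (\<Sum>i\<in>UNIV. \<Sum>j\<in>UNIV. partial_deriv j (partial_deriv i u) x * (z $ i * z $ j)) / 2) (at_right 0)"
proof (rule uniform_limitI)
  fix e :: real assume e: "0 < e"
  let ?N = "real CARD('n)"
  let ?H = "\<lambda>y i j. partial_deriv j (partial_deriv i u) y"
  \<comment> \<open>Each of the n^2 entries contributes at most \<open>d\<close>, since the
    coordinates of \<open>z\<close> are bounded by 1. The sum is at most \<open>e\<close>, and the
    factor 1/2 of the Taylor term makes the estimate strict.\<close>
  define d where "d = e / ?N\<^sup>2"
  have d: "0 < d" "?N * (?N * d) = e" using e by (auto simp: d_def power2_eq_square)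
  have "continuous_on S (\<lambda>y. ?H y i j)" for i j
    using u by (simp add: numeral_2_eq_2)
  then have "isCont (\<lambda>y. ?H y i j) x" for i j
    using assms(1,2) continuous_on_eq_continuous_at by blast
  then have "((\<lambda>y. ?H y i j) \<longlongrightarrow> ?H x i j) (nhds x)" for i j
    by (simp add: isCont_def tendsto_at_iff_tendsto_nhds)
  from tendstoD[OF this d(1)] have "\<forall>\<^sub>F y in nhds x. \<bar>?H y i j - ?H x i j\<bar> < d" for i j
    by (simp add: dist_real_def)
  then have "\<forall>\<^sub>F y in nhds x. \<forall>i j. \<bar>?H y i j - ?H x i j\<bar> < d"
    by (simp add: eventually_all_finite)
  moreover have "\<forall>\<^sub>F y in nhds x. y \<in> S"
    using assms(1,2) by (rule eventually_nhds_in_open)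
  ultimately have "\<forall>\<^sub>F y in nhds x. y \<in> S \<and> (\<forall>i j. \<bar>?H y i j - ?H x i j\<bar> < d)"
    by eventually_elim blast
  then obtain \<delta> where \<delta>: "0 < \<delta>" "\<And>y. dist y x < \<delta> \<Longrightarrow> y \<in> S \<and> (\<forall>i j. \<bar>?H y i j - ?H x i j\<bar> < d)"
    unfolding eventually_nhds_metric by blast
  have "\<forall>\<^sub>F r in at_right 0. r \<in> {0<..<\<delta>}"
    using \<delta>(1) by (rule eventually_at_right_real)
  then show "\<forall>\<^sub>F r in at_right 0. \<forall>z\<in>ball 0 1. dist ((u (x + r *\<^sub>R z) - u x - r * (gradient u x \<bullet> z)) / r\<^sup>2)
     ((\<Sum>i\<in>UNIV. \<Sum>j\<in>UNIV. ?H x i j * (z $ i * z $ j)) / 2) < e"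
  proof eventually_elim
    case (elim r)
    show ?case
    proof
      fix z :: "real^'n" assume "z \<in> ball 0 1"
      then have z: "norm z < 1" by simp
      have r: "0 < r" "r < \<delta>" using elim by auto
      have near: "dist (x + t *\<^sub>R (r *\<^sub>R z)) x < \<delta>" if "0 \<le> t" "t \<le> 1" for t
      proof -
        have "t * (r * norm z) \<le> 1 * (r * 1)"
          using that r z by (intro mult_mono) auto
        moreover have "dist (x + t *\<^sub>R (r *\<^sub>R z)) x = t * (r * norm z)"
          using that r by (simp add: dist_norm)
        ultimately show ?thesis using r by linarith
      qed
      obtain t where t: "0 < t" "t < 1" "u (x + r *\<^sub>R z) = u x + gradient u x \<bullet> (r *\<^sub>R z)
          + (\<Sum>i\<in>UNIV. \<Sum>j\<in>UNIV. ?H (x + t *\<^sub>R (r *\<^sub>R z)) i j * ((r *\<^sub>R z) $ i * (r *\<^sub>R z) $ j)) / 2"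
        using Taylor_second_order[OF u, of x "r *\<^sub>R z"] near \<delta>(2) by blast
      let ?y = "x + t *\<^sub>R (r *\<^sub>R z)"
      have "(u (x + r *\<^sub>R z) - u x - r * (gradient u x \<bullet> z)) / r\<^sup>2
          = (\<Sum>i\<in>UNIV. \<Sum>j\<in>UNIV. ?H ?y i j * (z $ i * z $ j)) / 2"
      proof -
        have "(\<Sum>i\<in>UNIV. \<Sum>j\<in>UNIV. ?H ?y i j * ((r *\<^sub>R z) $ i * (r *\<^sub>R z) $ j))
            = r\<^sup>2 * (\<Sum>i\<in>UNIV. \<Sum>j\<in>UNIV. ?H ?y i j * (z $ i * z $ j))"
          by (simp add: sum_distrib_left power2_eq_square mult_ac)
        then show ?thesis using r t(3) by simp
      qed
      then have "dist ((u (x + r *\<^sub>R z) - u x - r * (gradient u x \<bullet> z)) / r\<^sup>2)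
          ((\<Sum>i\<in>UNIV. \<Sum>j\<in>UNIV. ?H x i j * (z $ i * z $ j)) / 2)
        = \<bar>\<Sum>i\<in>UNIV. \<Sum>j\<in>UNIV. (?H ?y i j - ?H x i j) * (z $ i * z $ j)\<bar> / 2"
        by (simp only: dist_real_def sum_subtractf left_diff_distrib flip: diff_divide_distrib) simp
      also have "\<dots> \<le> (\<Sum>i\<in>(UNIV::'n set). \<Sum>j\<in>(UNIV::'n set). d) / 2"
      proof (intro divide_right_mono order.trans[OF sum_abs] sum_mono)
        fix i j
        have zi: "\<bar>z $ i\<bar> \<le> 1" for i using component_le_norm_cart[of z i] z by linarith
        have "\<bar>?H ?y i j - ?H x i j\<bar> * (\<bar>z $ i\<bar> * \<bar>z $ j\<bar>) \<le> d * (1 * 1)"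
          using \<delta>(2)[OF near[of t]] t(1,2) zi d(1) by (intro mult_mono) (auto intro: less_imp_le)
        then show "\<bar>(?H ?y i j - ?H x i j) * (z $ i * z $ j)\<bar> \<le> d"
          by (simp add: abs_mult)
      qed simp
      also have "\<dots> < e" using d e by simp
      finally show "dist ((u (x + r *\<^sub>R z) - u x - r * (gradient u x \<bullet> z)) / r\<^sup>2)
          ((\<Sum>i\<in>UNIV. \<Sum>j\<in>UNIV. ?H x i j * (z $ i * z $ j)) / 2) < e" .
    qed
  qed
qed

subsection \<open>Weighted measures of small balls\<close>

lemma LINT_ball_rescale:
  fixes f :: "'a::euclidean_space \<Rightarrow> real"
  assumes "0 < r" and f: "f \<in> borel_measurable borel"
  shows "(LINT y:ball x r|lborel. f y) = r ^ DIM('a) * (LINT z:ball 0 1|lborel. f (x + r *\<^sub>R z))"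
proof -
  have T: "(\<lambda>z. x + r *\<^sub>R z) \<in> measurable lborel (borel :: 'a measure)" by simp
  have F: "(\<lambda>y. indicator (ball x r) y * f y) \<in> borel_measurable borel"
    using f by (intro borel_measurable_times borel_measurable_indicator) auto
  have "(LINT y:ball x r|lborel. f y) =
      (LINT y|density (distr lborel borel (\<lambda>z. x + r *\<^sub>R z)) (\<lambda>_. ennreal (\<bar>r\<bar> ^ DIM('a))). indicator (ball x r) y * f y)"
    using lborel_affine[of r x] \<open>0 < r\<close> by (simp add: set_lebesgue_integral_def)
  also have "\<dots> = (LINT y|distr lborel borel (\<lambda>z. x + r *\<^sub>R z). \<bar>r\<bar> ^ DIM('a) *\<^sub>R (indicator (ball x r) y * f y))"
    using F by (intro integral_density) auto
  also have "\<dots> = (LINT z|lborel. \<bar>r\<bar> ^ DIM('a) *\<^sub>R (indicator (ball x r) (x + r *\<^sub>R z) * f (x + r *\<^sub>R z)))"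
    using T F by (intro integral_distr borel_measurable_scaleR) auto
  also have "\<dots> = (LINT z|lborel. r ^ DIM('a) * (indicator (ball 0 1) z * f (x + r *\<^sub>R z)))"
    using \<open>0 < r\<close> by (intro Bochner_Integration.integral_cong) (auto simp: indicator_def dist_norm)
  finally show ?thesis by (simp add: set_lebesgue_integral_def)
qed

text \<open>Since \<open>ennreal\<close> sends negative reals to 0, the density is really the
  positive part of \<open>w\<close>, which equals \<open>w\<close> on \<open>A\<close>.
  Measurability is asked of the product with the indicator because the integrands met later are
  controlled only on a small ball.\<close>

lemma LINT_weighted_measure:
  assumes "open \<Omega>" "continuous_on \<Omega> w" "A \<in> sets borel" "A \<subseteq> \<Omega>" "\<And>y. y \<in> A \<Longrightarrow> 0 \<le> w y"
    and f: "(\<lambda>y. indicator A y * f y) \<in> borel_measurable borel"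
  shows "(LINT y:A|weighted_measure \<Omega> w. f y) = (LINT y:A|lborel. w y * f y)"
proof -
  have "w \<in> borel_measurable (restrict_space lborel \<Omega>)"
    using borel_measurable_continuous_on_restrict[OF assms(2)]
    by (simp add: measurable_def space_restrict_space sets_restrict_space)
  then have w: "(\<lambda>y. max 0 (w y)) \<in> borel_measurable (restrict_space lborel \<Omega>)"
    by simp
  have f': "(\<lambda>y. indicator A y * f y) \<in> borel_measurable (restrict_space lborel \<Omega>)"
    using f by (intro measurable_restrict_space1) simp
  have "ennreal (w y) = ennreal (max 0 (w y))" for y
    by (simp add: max_def ennreal_neg)
  then have "weighted_measure \<Omega> w = density (restrict_space lborel \<Omega>) (\<lambda>y. ennreal (max 0 (w y)))"
    unfolding weighted_measure_def by presburger
  then have "(LINT y:A|weighted_measure \<Omega> w. f y) =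
      (LINT y|density (restrict_space lborel \<Omega>) (\<lambda>y. ennreal (max 0 (w y))). indicator A y * f y)"
    by (simp add: set_lebesgue_integral_def)
  also have "\<dots> = (LINT y|restrict_space lborel \<Omega>. max 0 (w y) *\<^sub>R (indicator A y * f y))"
    using w f' by (intro integral_density) auto
  also have "\<dots> = (LINT y|lborel. indicator \<Omega> y *\<^sub>R (max 0 (w y) *\<^sub>R (indicator A y * f y)))"
    using assms(1) by (intro integral_restrict_space) auto
  also have "\<dots> = (LINT y:A|lborel. w y * f y)"
    unfolding set_lebesgue_integral_def using assms(4,5)
    by (intro Bochner_Integration.integral_cong) (auto simp: indicator_def max_def)
  finally show ?thesis .
qed

lemma measure_weighted_measure:
  assumes "open \<Omega>" "continuous_on \<Omega> w" "A \<in> sets borel" "A \<subseteq> \<Omega>" "\<And>y. y \<in> A \<Longrightarrow> 0 \<le> w y"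
  shows "measure (weighted_measure \<Omega> w) A = (LINT y:A|lborel. w y)"
proof -
  have "space (weighted_measure \<Omega> w) = \<Omega>"
    by (simp add: weighted_measure_def space_restrict_space)
  then have "measure (weighted_measure \<Omega> w) A = (LINT y:A|weighted_measure \<Omega> w. 1)"
    using assms(4) by (simp add: set_lebesgue_integral_def Int_absorb2)
  also have "\<dots> = (LINT y:A|lborel. w y)"
    using assms by (subst LINT_weighted_measure) auto
  finally show ?thesis .
qed


section \<open>First-order expansion of ball averages of the weight\<close>

lemma LINT_ball_shift_measurable:
  fixes W :: "'a::euclidean_space \<Rightarrow> real"
  assumes [measurable]: "W \<in> borel_measurable borel"
  shows "(\<lambda>y. LINT z:ball 0 1|lborel. W (y + r *\<^sub>R z)) \<in> borel_measurable borel"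
proof -
  have [measurable]: "ball (0::'a) 1 \<in> sets borel" by simp
  have "(\<lambda>(y, z). indicator (ball (0::'a) 1) z *\<^sub>R W (y + r *\<^sub>R z)) \<in> borel_measurable (borel \<Otimes>\<^sub>M borel)"
    by measurable
  also have "borel_measurable (borel \<Otimes>\<^sub>M borel) = borel_measurable (borel \<Otimes>\<^sub>M (lborel :: 'a measure))"
    by (intro measurable_cong_sets sets_pair_measure_cong) auto
  finally show ?thesis
    unfolding set_lebesgue_integral_def by (rule lborel.borel_measurable_lebesgue_integral)
qed

text \<open>The average around \<open>x + r *\<^sub>R z\<close> samples \<open>W\<close> at
  \<open>x + r *\<^sub>R (z + v)\<close>. As \<open>z + v\<close> stays in the ball of radius 2, the
  first-order expansion at \<open>x\<close> is uniform in both variables; integrating over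
  \<open>v\<close> removes the contribution of \<open>v\<close>.\<close>

lemma ball_average_expansion:
  fixes W :: "real^'n::finite \<Rightarrow> real" and x p :: "real^'n"
  defines "B \<equiv> ball (0::real^'n) 1"
  defines "J \<equiv> (\<lambda>r y. LINT z:B|lborel. W (y + r *\<^sub>R z))"
  assumes meas [measurable]: "W \<in> borel_measurable borel" and bdd: "bounded (range W)"
    and W: "(W has_derivative (\<lambda>h. p \<bullet> h)) (at x)"
  shows "uniform_limit B (\<lambda>r z. (J r (x + r *\<^sub>R z) - measure lborel B * W x) / r)
    (\<lambda>z. measure lborel B * (p \<bullet> z)) (at_right 0)"
proof -
  let ?m = "measure lborel B"
  have B: "B \<in> sets lborel" "emeasure lborel B < \<infinity>" by (auto simp: B_def)
  define E where "E r v = (W (x + r *\<^sub>R v) - W x) / r" for r v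
  have [measurable]: "(\<lambda>v. E r (z + v)) \<in> borel_measurable borel" for r z
    unfolding E_def by measurable
  have E: "uniform_limit (ball 0 2) E (\<lambda>v. p \<bullet> v) (at_right 0)"
    unfolding E_def using W by (rule has_derivative_imp_uniform_limit) simp
  have plus: "(\<lambda>(z, v). z + v) \<in> B \<times> B \<rightarrow> ball 0 2"
  proof clarsimp
    fix z v :: "real^'n" assume "z \<in> B" "v \<in> B"
    then show "norm (z + v) < 2"
      using norm_triangle_ineq[of z v] by (simp add: B_def)
  qed
  have "uniform_limit (B \<times> B) (\<lambda>r (z, v). E r (z + v)) (\<lambda>(z, v). p \<bullet> (z + v)) (at_right 0)"
    using uniform_limit_compose'[OF E plus] by (simp add: case_prod_beta')
  then have lim: "uniform_limit B (\<lambda>r z. LINT v:B|lborel. E r (z + v)) (\<lambda>z. LINT v:B|lborel. p \<bullet> (z + v)) (at_right 0)"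
  proof (rule uniform_limit_set_lebesgue_integral[OF B, rotated -1])
    show "bounded ((\<lambda>v. p \<bullet> (z + v)) ` B)" for z
      unfolding B_def by (intro bounded_image_ball_continuous continuous_intros)
  qed auto
  have const: "set_integrable lborel B (\<lambda>_. c)" for c :: real
    using B by (intro set_integrable_bounded_on) (auto simp: bounded_iff)
  have "(LINT v:B|lborel. p \<bullet> (z + v)) = ?m * (p \<bullet> z)" for z
    using const[of "p \<bullet> z"] LINT_ball_linear[of p, folded B_def] B
    by (simp add: inner_add_right set_integral_add set_integral_const)
  moreover have "(LINT v:B|lborel. E r (z + v)) = (J r (x + r *\<^sub>R z) - ?m * W x) / r" for r z
  proof -
    have "set_integrable lborel B (\<lambda>v. W (x + r *\<^sub>R z + r *\<^sub>R v))"
      using B by (intro set_integrable_bounded_on bounded_subset[OF bdd]) auto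
    then have "(LINT v:B|lborel. (W (x + r *\<^sub>R z + r *\<^sub>R v) - W x) / r) = (J r (x + r *\<^sub>R z) - ?m * W x) / r"
      using const[of "W x"] B by (simp add: J_def set_integral_diff set_integral_const)
    then show ?thesis by (simp add: E_def scaleR_add_right add.assoc)
  qed
  ultimately show ?thesis using lim by simp
qed

text \<open>Put m = |B| and let E and K be the difference quotients with W(x + r z) = W(x) + r E and
  J = m W(x) + r K. Then (W/J - 1/m)/r = (m E - K)/(m J). For the fixed centre, K is taken at z = 0
  and tends to 0, leaving the limit of E. For the moving centre, K tends to m <p, z>, which is also
  the limit of m E.\<close>

lemma uniform_limit_weight_over_ball_average:
  fixes W :: "real^'n::finite \<Rightarrow> real" and x p :: "real^'n"
  defines "B \<equiv> ball (0::real^'n) 1"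
  defines "J \<equiv> (\<lambda>r y. LINT z:B|lborel. W (y + r *\<^sub>R z))"
  assumes meas: "W \<in> borel_measurable borel" and bdd: "bounded (range W)"
    and W: "(W has_derivative (\<lambda>h. p \<bullet> h)) (at x)" and pos: "0 < W x"
  shows "uniform_limit B (\<lambda>r z. (W (x + r *\<^sub>R z) / J r x - 1 / measure lborel B) / r)
      (\<lambda>z. ((1 / (measure lborel B * W x)) *\<^sub>R p) \<bullet> z) (at_right 0)" (is ?center)
    and "uniform_limit B (\<lambda>r z. (W (x + r *\<^sub>R z) / J r (x + r *\<^sub>R z) - 1 / measure lborel B) / r)
      (\<lambda>z. 0) (at_right 0)" (is ?moving)
proof -
  define m where "m = measure lborel B"
  have m: "0 < m" by (simp add: m_def B_def)
  define E where "E r v = (W (x + r *\<^sub>R v) - W x) / r" for r v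
  define K where "K r v = (J r (x + r *\<^sub>R v) - m * W x) / r" for r v
  have bl: "bounded ((\<lambda>z. c * (p \<bullet> z)) ` B)" for c
    unfolding B_def by (intro bounded_image_ball_continuous continuous_intros)
  have bc: "bounded ((\<lambda>z. c) ` B)" for c :: real
    by (auto simp: bounded_iff)
  have E: "uniform_limit B E (\<lambda>z. p \<bullet> z) (at_right 0)"
    unfolding E_def using W by (rule has_derivative_imp_uniform_limit) (simp add: B_def)
  have K: "uniform_limit B K (\<lambda>z. m * (p \<bullet> z)) (at_right 0)"
    using ball_average_expansion[OF meas bdd W] by (simp add: K_def[abs_def] J_def B_def m_def)
  have r0: "uniform_limit B (\<lambda>r z. r) (\<lambda>z. 0::real) (at_right 0)"
    by (auto simp: uniform_limit_iff eventually_at dist_real_def)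
  have "uniform_limit B (\<lambda>r z. m * W x + r * K r z) (\<lambda>z. m * W x + 0 * (m * (p \<bullet> z))) (at_right 0)"
    by (intro uniform_limit_add uniform_lim_mult uniform_limit_const r0 K bl bc)
  moreover have "\<forall>\<^sub>F r in at_right 0. \<forall>z\<in>B. m * W x + r * K r z = J r (x + r *\<^sub>R z)"
    using eventually_at_right_less[of "0::real"] by eventually_elim (auto simp: K_def)
  ultimately have J: "uniform_limit B (\<lambda>r z. J r (x + r *\<^sub>R z)) (\<lambda>z. m * W x) (at_right 0)"
    by (subst uniform_limit_cong[symmetric, where f="\<lambda>r z. m * W x + r * K r z" and h="\<lambda>z. m * W x"]) auto
  have B0: "0 \<in> B" by (simp add: B_def)
  have K0: "uniform_limit B (\<lambda>r z. K r 0) (\<lambda>z. 0) (at_right 0)"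
    using uniform_limit_compose'[OF K, of "\<lambda>_. 0" B] B0 by simp
  have J0: "uniform_limit B (\<lambda>r z. J r x) (\<lambda>z. m * W x) (at_right 0)"
    using uniform_limit_compose'[OF J, of "\<lambda>_. 0" B] B0 by simp
  have mW: "0 < m * W x" "0 < m * (m * W x)" using m pos by simp_all
  have Jpos: "\<forall>\<^sub>F r in at_right 0. \<forall>z\<in>B. 0 < J r (x + r *\<^sub>R z)"
    using uniform_limitD[OF J mW(1)] by eventually_elim (fastforce simp: dist_real_def)
  have "uniform_limit B (\<lambda>r z. (m * E r z - K r 0) / (m * J r x))
      (\<lambda>z. (m * (p \<bullet> z) - 0) / (m * (m * W x))) (at_right 0)"
    using bl[of m] mW(2) bl[of 1] bc
    by (intro uniform_lim_divide[where b="m * (m * W x)"] uniform_limit_minus uniform_lim_mult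
        uniform_limit_const E K0 J0) auto
  moreover have "\<forall>\<^sub>F r in at_right 0. \<forall>z\<in>B. (m * E r z - K r 0) / (m * J r x) = (W (x + r *\<^sub>R z) / J r x - 1 / m) / r"
    using eventually_at_right_less[of "0::real"] Jpos
  proof eventually_elim
    case (elim r)
    have "0 < J r x" using elim(2) B0 by fastforce
    then show ?case using elim(1) m unfolding E_def K_def by (auto simp: field_simps)
  qed
  moreover have "(m * (p \<bullet> z) - 0) / (m * (m * W x)) = ((1 / (m * W x)) *\<^sub>R p) \<bullet> z" for z
    using m by (simp add: field_simps)
  ultimately show ?center
    unfolding m_def[symmetric]
    by (subst uniform_limit_cong[symmetric, where f="\<lambda>r z. (m * E r z - K r 0) / (m * J r x)"]) auto
  have "uniform_limit B (\<lambda>r z. (m * E r z - K r z) / (m * J r (x + r *\<^sub>R z)))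
      (\<lambda>z. (m * (p \<bullet> z) - m * (p \<bullet> z)) / (m * (m * W x))) (at_right 0)"
    using bl[of m] mW(2) bl[of 1] bc
    by (intro uniform_lim_divide[where b="m * (m * W x)"] uniform_limit_minus uniform_lim_mult
        uniform_limit_const E K J) auto
  moreover have "\<forall>\<^sub>F r in at_right 0. \<forall>z\<in>B. (m * E r z - K r z) / (m * J r (x + r *\<^sub>R z)) =
      (W (x + r *\<^sub>R z) / J r (x + r *\<^sub>R z) - 1 / m) / r"
    using eventually_at_right_less[of "0::real"] Jpos
  proof eventually_elim
    case (elim r)
    show ?case
    proof
      fix z assume "z \<in> B"
      then have "0 < J r (x + r *\<^sub>R z)" using elim(2) by blast
      then show "(m * E r z - K r z) / (m * J r (x + r *\<^sub>R z)) = (W (x + r *\<^sub>R z) / J r (x + r *\<^sub>R z) - 1 / m) / r"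
        using elim(1) m unfolding E_def K_def by (auto simp: field_simps)
    qed
  qed
  ultimately show ?moving
    unfolding m_def[symmetric]
    by (subst uniform_limit_cong[symmetric, where f="\<lambda>r z. (m * E r z - K r z) / (m * J r (x + r *\<^sub>R z))"]) auto
qed

section \<open>Localisation near the point and evaluation of the two limits\<close>

theorem proposition5p1:
  fixes \<Omega> :: "(real ^ 'n::finite) set"
    and w u :: "real ^ 'n \<Rightarrow> real"
    and \<mu> :: "(real ^ 'n) measure"
    and x :: "real ^ 'n"
  assumes "open \<Omega>"
    and "Ck_on 1 \<Omega> w"
    and "\<mu> = weighted_measure \<Omega> w"
    and "metric_measure_space \<Omega> dist \<mu>"
    and "x \<in> \<Omega>" and "w x > 0"
    and "Ck_on 2 \<Omega> u"
  shows "metric_measure_space.admits_AMV_laplacian \<Omega> dist \<mu> u x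
    \<and> metric_measure_space.admits_SAMV_laplacian \<Omega> dist \<mu> u x
    \<and> metric_measure_space.AMV_laplacian \<Omega> dist \<mu> u x =
        1 / (2 * (real CARD('n) + 2)) *
          (laplacian u x + 2 * (gradient (\<lambda>y. ln (w y)) x \<bullet> gradient u x))
    \<and> metric_measure_space.SAMV_laplacian \<Omega> dist \<mu> u x =
        1 / (2 * (real CARD('n) + 2)) *
          (laplacian u x + gradient (\<lambda>y. ln (w y)) x \<bullet> gradient u x)"
proof -
  interpret metric_measure_space \<Omega> dist \<mu> by fact
  let ?B = "ball (0::real^'n) 1"
  have mball: "mball y r = \<Omega> \<inter> ball y r" if "y \<in> \<Omega>" for y r
    using that by (auto simp: mball_def)
  have w_diff: "w differentiable (at y)" if "y \<in> \<Omega>" for y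
    using assms(2) that by simp
  have u_diff: "u differentiable (at y)" if "y \<in> \<Omega>" for y
    using assms(7) that by (simp add: numeral_2_eq_2)
  have w_cont: "continuous_on \<Omega> w" and u_cont: "continuous_on \<Omega> u"
    using differentiable_imp_continuous_within[OF w_diff] differentiable_imp_continuous_within[OF u_diff]
    by (auto intro!: continuous_at_imp_continuous_on)
  obtain R1 where R1: "0 < R1" "ball x R1 \<subseteq> {y \<in> \<Omega>. 0 < w y}"
  proof -
    have "open (\<Omega> \<inter> w -` {0<..})"
      using w_cont assms(1) by (intro continuous_open_preimage) auto
    then show ?thesis
      using that assms(5,6) unfolding open_contains_ball by (auto simp: subset_eq)
  qed
  \<comment> \<open>Halving the radius puts the closed ball inside the region where \<open>w\<close>
    is positive; its compactness then bounds \<open>W\<close>.\<close>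
  define R where "R = R1 / 2"
  have R: "0 < R" "cball x R \<subseteq> \<Omega>" "\<And>y. y \<in> cball x R \<Longrightarrow> 0 < w y"
    using R1 by (auto simp: R_def subset_eq)
  then have R': "ball x R \<subseteq> \<Omega>" by auto
  \<comment> \<open>Truncation yields functions that are Borel on the whole space, as rescaling and
    Fubini arguments require, and that have the same germ at \<open>x\<close> as \<open>w\<close>
    and \<open>u\<close>.\<close>
  define W where "W y = indicator (ball x R) y * w y" for y
  define U where "U y = indicator (ball x R) y * u y" for y
  have eq: "W y = w y" "U y = u y" if "y \<in> ball x R" for y
    using that by (auto simp: W_def U_def)
  have [measurable]: "W \<in> borel_measurable borel"
    using borel_measurable_continuous_on_indicator[of "ball x R" w] continuous_on_subset[OF w_cont R']
    by (simp add: W_def[abs_def])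
  have [measurable]: "U \<in> borel_measurable borel"
    using borel_measurable_continuous_on_indicator[of "ball x R" u] continuous_on_subset[OF u_cont R']
    by (simp add: U_def[abs_def])
  have "bounded (range W)"
  proof -
    have "bounded (w ` cball x R)"
      using continuous_on_subset[OF w_cont R(2)] by (intro compact_imp_bounded compact_continuous_image) auto
    then have "bounded (insert 0 (w ` cball x R))" by simp
    then show ?thesis
      by (rule bounded_subset) (auto simp: W_def indicator_def)
  qed
  have x: "x \<in> ball x R" using R by simp
  define p where "p = gradient w x"
  have W_deriv: "(W has_derivative (\<lambda>h. p \<bullet> h)) (at x)"
    using has_derivative_gradient[OF w_diff[OF assms(5)]] unfolding p_def
    by (rule has_derivative_transform_within_open[where s="ball x R"]) (use x eq in auto)
  have Wx: "0 < W x" using eq(1)[OF x] assms(6) by simp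
  define m where "m = measure lborel ?B"
  have m: "0 < m" by (simp add: m_def)
  define J where "J = (\<lambda>r y. LINT z:?B|lborel. W (y + r *\<^sub>R z))"
  \<comment> \<open>The SAMV integrand contains \<open>J r (x + r *\<^sub>R z)\<close>, so
    \<open>J r\<close> must be Borel in its centre.\<close>
  have [measurable]: "J r \<in> borel_measurable borel" for r
    unfolding J_def by (rule LINT_ball_shift_measurable) measurable
  have lim_center: "uniform_limit ?B (\<lambda>r z. (W (x + r *\<^sub>R z) / J r x - 1 / m) / r)
      (\<lambda>z. ((1 / (m * W x)) *\<^sub>R p) \<bullet> z) (at_right 0)"
    and lim_moving: "uniform_limit ?B (\<lambda>r z. (W (x + r *\<^sub>R z) / J r (x + r *\<^sub>R z) - 1 / m) / r)
      (\<lambda>z. 0) (at_right 0)"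
    unfolding J_def m_def
    by (rule uniform_limit_weight_over_ball_average[OF _ \<open>bounded (range W)\<close> W_deriv Wx]; measurable)+
  \<comment> \<open>For r below R/2, every ball of radius r centred in \<open>ball x r\<close> lies
    in \<open>ball x R\<close>. The SAMV quotient uses all of these balls.\<close>
  have small: "\<forall>\<^sub>F r in at_right 0. r \<in> {0<..<R / 2}"
    using R(1) by (intro eventually_at_right_real) simp
  have near: "x + r *\<^sub>R z \<in> ball x R" if "r \<in> {0<..<R / 2}" "z \<in> ?B" for r z
  proof -
    have "r * norm z \<le> r * 1" using that by (intro mult_left_mono) auto
    moreover have "r < R" "0 < r" using that R by auto
    ultimately have "r * norm z < R" by linarith
    then show ?thesis using that by (simp add: dist_norm)
  qed
  have U_lim: "uniform_limit ?B (\<lambda>r z. (U (x + r *\<^sub>R z) - U x - r * (gradient u x \<bullet> z)) / r\<^sup>2)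
    (\<lambda>z. (\<Sum>i\<in>UNIV. \<Sum>j\<in>UNIV. partial_deriv j (partial_deriv i u) x * (z $ i * z $ j)) / 2) (at_right 0)"
  proof -
    have "\<forall>\<^sub>F r in at_right 0. \<forall>z\<in>?B. (u (x + r *\<^sub>R z) - u x - r * (gradient u x \<bullet> z)) / r\<^sup>2 =
       (U (x + r *\<^sub>R z) - U x - r * (gradient u x \<bullet> z)) / r\<^sup>2"
      using small by eventually_elim (use eq x near in auto)
    then show ?thesis
      using uniform_limit_Taylor_second_order[OF assms(1,5,7)]
      by (subst uniform_limit_cong[symmetric]) auto
  qed
  have measure_mball: "measure \<mu> (mball y r) = r ^ CARD('n) * J r y" and mball_eq: "mball y r = ball y r"
    if "r \<in> {0<..<R / 2}" "y \<in> ball x r" for y r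
  proof -
    have sub: "ball y r \<subseteq> ball x R"
      using that by (auto simp: dist_commute intro!: dist_triangle_less_add[of x y] simp: ball_subset_ball_iff)
    have "y \<in> \<Omega>" using that R' by (auto simp: subset_eq)
    then show mb: "mball y r = ball y r" using mball sub R' by auto
    have "measure \<mu> (ball y r) = (LINT z:ball y r|lborel. w z)"
      using sub R' R(3) assms(1) w_cont unfolding assms(3)
      by (intro measure_weighted_measure) (auto simp: less_imp_le subset_eq)
    also have "\<dots> = (LINT z:ball y r|lborel. W z)"
      using sub eq by (intro set_lebesgue_integral_cong) auto
    also have "\<dots> = r ^ CARD('n) * J r y"
      using that unfolding J_def by (subst LINT_ball_rescale) auto
    finally show "measure \<mu> (mball y r) = r ^ CARD('n) * J r y" unfolding mb .
  qed
  \<comment> \<open>Here \<open>g\<close> is the factor as it occurs in the definitions and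
    \<open>G\<close> a Borel function agreeing with it on the ball: the constant 1 for AMV, and 1 +
    J_r(x)/J_r(y) for SAMV. The powers of r from the integral and from the measure of the ball
    cancel.\<close>
  have average_eq: "average \<mu> (mball x r) (\<lambda>y. (u y - u x) * g y) =
      (LINT z:?B|lborel. (U (x + r *\<^sub>R z) - U x) * (W (x + r *\<^sub>R z) * G (x + r *\<^sub>R z) / J r x))"
    if r: "r \<in> {0<..<R / 2}" and [measurable]: "G \<in> borel_measurable borel" and g: "\<And>y. y \<in> ball x r \<Longrightarrow> g y = G y"
    for r g G
  proof -
    have sub: "ball x r \<subseteq> ball x R" and xr: "x \<in> ball x r" using r R by auto
    have "(\<lambda>y. indicator (ball x r) y * ((u y - u x) * g y)) = (\<lambda>y. indicator (ball x r) y * ((U y - U x) * G y))"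
      using g sub eq x by (auto simp: indicator_def fun_eq_iff subset_eq)
    moreover have "(\<lambda>y. indicator (ball x r) y * ((U y - U x) * G y)) \<in> borel_measurable borel"
      by (intro borel_measurable_times borel_measurable_indicator) auto
    ultimately have "(LINT y:ball x r|\<mu>. (u y - u x) * g y) = (LINT y:ball x r|lborel. w y * ((u y - u x) * g y))"
      using sub R' R(3) assms(1) w_cont unfolding assms(3)
      by (intro LINT_weighted_measure) (auto simp: less_imp_le subset_eq)
    also have "\<dots> = (LINT y:ball x r|lborel. W y * ((U y - U x) * G y))"
      using sub eq g x by (intro set_lebesgue_integral_cong) (auto simp: subset_eq)
    also have "\<dots> = r ^ CARD('n) * (LINT z:?B|lborel. W (x + r *\<^sub>R z) * ((U (x + r *\<^sub>R z) - U x) * G (x + r *\<^sub>R z)))"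
      using r by (subst LINT_ball_rescale) auto
    finally have "average \<mu> (mball x r) (\<lambda>y. (u y - u x) * g y) =
        (LINT z:?B|lborel. W (x + r *\<^sub>R z) * ((U (x + r *\<^sub>R z) - U x) * G (x + r *\<^sub>R z))) / J r x"
      unfolding average_def measure_mball[OF r xr] unfolding mball_eq[OF r xr]
      using r by (simp add: field_simps)
    also have "\<dots> = (LINT z:?B|lborel. W (x + r *\<^sub>R z) * ((U (x + r *\<^sub>R z) - U x) * G (x + r *\<^sub>R z)) / J r x)"
      by simp
    finally show ?thesis by (simp add: mult_ac)
  qed
  have lap: "(\<Sum>i\<in>UNIV. partial_deriv i (partial_deriv i u) x) = laplacian u x"
    by (simp add: laplacian_def)
  have grad: "p = w x *\<^sub>R gradient (\<lambda>y. ln (w y)) x"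
    using gradient_ln[OF w_diff[OF assms(5)] assms(6)] assms(6) by (simp add: p_def)
  have Wxw: "W x = w x" using eq x by simp

  have lim1: "((\<lambda>r. AMV_approx r u x) \<longlongrightarrow> 1 / (2 * (real CARD('n) + 2)) *
          (laplacian u x + 2 * (gradient (\<lambda>y. ln (w y)) x \<bullet> gradient u x))) (at_right 0)"
  proof -
    have "((\<lambda>r. (1 / r\<^sup>2) * (LINT z:?B|lborel. (U (x + r *\<^sub>R z) - U x) * (W (x + r *\<^sub>R z) / J r x))) \<longlongrightarrow>
        m / (CARD('n) + 2) * (1 / m * (\<Sum>i\<in>UNIV. partial_deriv i (partial_deriv i u) x) / 2
          + gradient u x \<bullet> ((1 / (m * W x)) *\<^sub>R p))) (at_right 0)"
      unfolding m_def by (rule second_order_average_limit[OF _ _ U_lim lim_center[unfolded m_def]]) measurable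
    moreover have "\<forall>\<^sub>F r in at_right 0. (1 / r\<^sup>2) * (LINT z:?B|lborel. (U (x + r *\<^sub>R z) - U x) * (W (x + r *\<^sub>R z) / J r x)) = AMV_approx r u x"
      using small
    proof eventually_elim
      case (elim r)
      show ?case
        using average_eq[OF elim, of "\<lambda>_. 1" "\<lambda>_. 1"] by (simp add: AMV_approx_def)
    qed
    moreover have "m / (CARD('n) + 2) * (1 / m * (\<Sum>i\<in>UNIV. partial_deriv i (partial_deriv i u) x) / 2
          + gradient u x \<bullet> ((1 / (m * W x)) *\<^sub>R p)) = 1 / (2 * (real CARD('n) + 2)) *
          (laplacian u x + 2 * (gradient (\<lambda>y. ln (w y)) x \<bullet> gradient u x))"
      using m assms(6) unfolding lap grad Wxw
      by (simp add: divide_simps inner_commute) (simp add: algebra_simps)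
    ultimately show ?thesis by (simp add: tendsto_cong)
  qed
  have lim2: "((\<lambda>r. SAMV_approx r u x) \<longlongrightarrow> 1 / (2 * (real CARD('n) + 2)) *
          (laplacian u x + gradient (\<lambda>y. ln (w y)) x \<bullet> gradient u x)) (at_right 0)"
  proof -
    define G where "G r z = (W (x + r *\<^sub>R z) / J r x + W (x + r *\<^sub>R z) / J r (x + r *\<^sub>R z)) / 2" for r z
    have "uniform_limit ?B (\<lambda>r z. ((W (x + r *\<^sub>R z) / J r x - 1 / m) / r +
        (W (x + r *\<^sub>R z) / J r (x + r *\<^sub>R z) - 1 / m) / r) / 2)
        (\<lambda>z. (((1 / (m * W x)) *\<^sub>R p) \<bullet> z + 0) / 2) (at_right 0)"
      unfolding divide_inverse[of _ 2] using lim_center lim_moving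
      by (intro bounded_linear.uniform_limit[OF bounded_linear_mult_left] uniform_limit_add) auto
    then have G_lim: "uniform_limit ?B (\<lambda>r z. (G r z - 1 / m) / r) (\<lambda>z. ((1 / (2 * m * W x)) *\<^sub>R p) \<bullet> z) (at_right 0)"
      by (simp add: G_def add_divide_distrib diff_divide_distrib mult_ac)
    have "((\<lambda>r. (1 / r\<^sup>2) * (LINT z:?B|lborel. (U (x + r *\<^sub>R z) - U x) * G r z)) \<longlongrightarrow>
        m / (CARD('n) + 2) * (1 / m * (\<Sum>i\<in>UNIV. partial_deriv i (partial_deriv i u) x) / 2
          + gradient u x \<bullet> ((1 / (2 * m * W x)) *\<^sub>R p))) (at_right 0)"
      unfolding m_def by (rule second_order_average_limit[OF _ _ U_lim G_lim[unfolded m_def]]) (unfold G_def, measurable)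
    moreover have "\<forall>\<^sub>F r in at_right 0. (1 / r\<^sup>2) * (LINT z:?B|lborel. (U (x + r *\<^sub>R z) - U x) * G r z) = SAMV_approx r u x"
    proof -
      \<comment> \<open>Rewriting the integrand with \<open>G r\<close> cancels \<open>J r x\<close>
        against itself, which fails under the convention that division by 0 gives 0. Positivity and
        finiteness of the measure of balls exclude that case.\<close>
      have "\<forall>\<^sub>F r in at_right 0. J r x \<noteq> 0"
        using small
      proof eventually_elim
        case (elim r)
        have "0 < measure \<mu> (mball x r)"
          using elim ball_pos[OF assms(5), of r] ball_finite[OF assms(5), of r]
          by (simp add: measure_def enn2real_positive_iff)
        then show ?case using measure_mball[OF elim, of x] elim by auto
      qed
      with small show ?thesis
      proof eventually_elim
        case (elim r)
        have xr: "x \<in> ball x r" using elim by simp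
        have ratio: "1 + measure \<mu> (mball x r) / measure \<mu> (mball y r) = 1 + J r x / J r y" if "y \<in> ball x r" for y
          using elim that by (simp add: measure_mball[OF elim(1)] xr)
        have "SAMV_approx r u x = 1 / (2 * r\<^sup>2) * (LINT z:?B|lborel. (U (x + r *\<^sub>R z) - U x) *
            (W (x + r *\<^sub>R z) * (1 + J r x / J r (x + r *\<^sub>R z)) / J r x))"
          unfolding SAMV_approx_def by (subst average_eq[OF elim(1) _ ratio]) auto
        also have "\<dots> = 1 / r\<^sup>2 * (LINT z:?B|lborel. (U (x + r *\<^sub>R z) - U x) *
            (W (x + r *\<^sub>R z) * (1 + J r x / J r (x + r *\<^sub>R z)) / J r x) / 2)"
          by simp
        also have "(\<lambda>z. (U (x + r *\<^sub>R z) - U x) * (W (x + r *\<^sub>R z) * (1 + J r x / J r (x + r *\<^sub>R z)) / J r x) / 2)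
            = (\<lambda>z. (U (x + r *\<^sub>R z) - U x) * G r z)"
          using elim(2) by (simp add: G_def fun_eq_iff add_divide_distrib distrib_left)
        finally show ?case ..
      qed
    qed
    moreover have "m / (CARD('n) + 2) * (1 / m * (\<Sum>i\<in>UNIV. partial_deriv i (partial_deriv i u) x) / 2
          + gradient u x \<bullet> ((1 / (2 * m * W x)) *\<^sub>R p)) = 1 / (2 * (real CARD('n) + 2)) *
          (laplacian u x + gradient (\<lambda>y. ln (w y)) x \<bullet> gradient u x)"
      using m assms(6) unfolding lap grad Wxw
      by (simp add: divide_simps inner_commute)
    ultimately show ?thesis by (simp add: tendsto_cong)
  qed
  show ?thesis
    using lim1 lim2 tendsto_Lim[OF trivial_limit_at_right_real lim1] tendsto_Lim[OF trivial_limit_at_right_real lim2]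
    unfolding admits_AMV_laplacian_def admits_SAMV_laplacian_def AMV_laplacian_def SAMV_laplacian_def
    by blast
qed

end
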